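(* For every integer $n\ge 1$, the following identity holds (as formal power series in $s$ and $t$): \[ \frac{1}{4}\left(\frac{(1+s)(1+t)}{(1-s)(1-t)}\right)^{n+1} W_n\!\left(\frac{4s}{(1+s)^2},\frac{4t}{(1+t)^2}\right) = \sum_{k,l\geq 0}\left(\sum_{m=1}^{n}\binom{2kl}{m} \binom{n-1}{m-1}2^m\right) s^k t^l . \]
   Context: Let $S_n$ be the symmetric group of permutations of $\{1,\dots,n\}$. A permutation $\pi\in S_n$ has a peak at position $i$, where $2\le i\le n-1$, if $\pi(i-1)<\pi(i)>\pi(i+1)$. Let $\mathrm{pk}(\pi)$ denote the number of peaks of $\pi$. The bivariate peak polynomial is \[ W_n(s,t)=\sum_{\pi\in S_n} s^{\mathrm{pk}(\pi)+1}\,t^{\mathrm{pk}(\pi^{-1})+1}. \] Binomial coefficients $\binom{N}{m}$ with $N$ a nonnegative integer are the usual ones, equal to $0$ when $m>N$. *)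

theory Defs
  imports
    Complex_Main
    "HOL-Combinatorics.Permutations"
    "HOL-Computational_Algebra.Formal_Power_Series"
begin

definition pk :: "nat \<Rightarrow> (nat \<Rightarrow> nat) \<Rightarrow> nat" where
  "pk n \<pi> = card {i. 2 \<le> i \<and> i \<le> n - 1 \<and> \<pi> (i - 1) < \<pi> i \<and> \<pi> i > \<pi> (i + 1)}"

text \<open>The bivariate peak polynomial, as a function of two elements of an arbitrary commutative
  (semi)ring, so that power series can be substituted for its variables.\<close>

definition peak_poly :: "nat \<Rightarrow> 'a \<Rightarrow> 'a \<Rightarrow> 'a :: comm_semiring_1" where
  "peak_poly n s t = (\<Sum>\<pi> | \<pi> permutes {1..n}. s ^ (pk n \<pi> + 1) * t ^ (pk n (inv \<pi>) + 1))"

text \<open>Formal power series in two variables \<open>s\<close>, \<open>t\<close> are series in \<open>t\<close> whose coefficients are series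
  in \<open>s\<close>.  The coefficient of \<open>s\<^sup>k t\<^sup>l\<close> in \<open>F\<close> is thus
  \<open>fps_nth (fps_nth F l) k\<close>.\<close>

definition var_s :: "rat fps fps" where
  "var_s = fps_const fps_X"

definition var_t :: "rat fps fps" where
  "var_t = fps_X"

definition bivar_fps :: "(nat \<Rightarrow> nat \<Rightarrow> rat) \<Rightarrow> rat fps fps" where
  "bivar_fps c = Abs_fps (\<lambda>l. Abs_fps (\<lambda>k. c k l))"

text \<open>The coefficient ring \<open>rat fps\<close> is not a field, but the library's quotient on \<open>rat fps fps\<close> is
  nevertheless the true one whenever the constant term of the divisor is nonzero:\<close>

lemma bivar_divide_mult_cancel:
  includes fps_syntax
  fixes F G :: "rat fps fps"
  assumes "G $ 0 $ 0 \<noteq> 0"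
  shows "F / G * G = F"
proof -
  have nz: "G $ 0 \<noteq> 0" using assms by auto
  have "inverse (G $ 0) * G $ 0 = 1" using assms by (rule inverse_mult_eq_1)
  then have inv: "inverse G * G = 1"
    using fps_right_inverse[of G "inverse (G $ 0)"] by (simp add: fps_inverse_def mult.commute)
  have "subdegree G = 0" using nz by simp
  then have "F / G = F * inverse G" using nz by (auto simp: fps_divide_def)
  then show ?thesis by (simp add: mult.assoc inv)
qed

end

theory Submission
  imports Defs "HOL-Library.FuncSet"
begin

text \<open>
  The coefficients of both sides count permutations \<open>\<pi>\<close> equipped with two words, one compatible with
  \<open>\<pi>\<close> and one with \<open>\<pi>\<^sup>-\<^sup>1\<close>, in the following sense.

  Fix a chain whose steps are marked as ascents or descents.  Call a weakly increasing word
  \<open>g\<^sub>1 \<le> \<dots> \<le> g\<^sub>n\<close> over \<open>{1..v}\<close> compatible with the marking if a repetition \<open>g\<^sub>i = g\<^sub>i\<^sub>+\<^sub>1\<close> of an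
  even letter occurs only at ascents and a repetition of an odd letter only at descents.  These are
  Stembridge's enriched P-partitions of the chain, with \<open>-1 < 1 < -2 < 2 < \<dots>\<close> renumbered as
  \<open>1 < 2 < 3 < 4 < \<dots>\<close>.  Let \<open>\<Omega>\<^sub>\<pi>(v)\<close> be their number for the ascents and descents of \<open>\<pi>\<close>.

  Two facts about \<open>\<Omega>\<close> give the theorem.

  \<^item> Its generating function depends on \<open>\<pi>\<close> through the number of peaks only, and is one factor of
    the left-hand side (\<open>enriched_even_eq_peaks\<close>):
    \<open>2 \<Sum>\<^sub>k \<Omega>\<^sub>\<pi>(2k) s\<^sup>k = ((1+s)/(1-s))\<^bsup>n+1\<^esup> (4s/(1+s)\<^sup>2)\<^bsup>pk(\<pi>)+1\<^esup>\<close>.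
    Appending a step multiplies the series over even bounds, or the one over odd bounds, by
    \<open>(1+s)/(1-s)\<close>, and the factor \<open>4s/(1+s)\<^sup>2\<close> is the cost of passing from one to the other at a peak.

  \<^item> The number \<open>\<Sum>\<^sub>\<pi> \<Omega>\<^sub>\<pi>(2k) \<Omega>\<^bsub>\<pi>\<^sup>-\<^sup>1\<^esub>(2l)\<close> is the coefficient of \<open>x\<^sup>n\<close> in
    \<open>((1+x)/(1-x))\<^bsup>2kl\<^esup>\<close>.  A permutation with a word compatible with its inverse is the same thing as
    an arbitrary word over \<open>{1..2l}\<close>, by a standardization that breaks ties according to parity
    (\<open>sum_standardization\<close>).  What remains to be counted are pairs of words, read as sequences of
    letters \<open>(u, v)\<close>; for a suitable linear order on the \<open>4kl\<close> letters these are exactly the sorted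
    sequences in which letters with \<open>u \<equiv> v\<close> mod 2 may be repeated and the others may not.
    Half of the letters thus contribute \<open>1/(1-x)\<close> and half contribute \<open>1+x\<close> (\<open>word_gf_eq\<close>).

  Expanding \<open>((1+x)/(1-x))\<^bsup>2kl\<^esup> = (1 + 2x/(1-x))\<^bsup>2kl\<^esup>\<close> by the binomial theorem gives the right-hand side.
\<close>

unbundle fps_syntax

section \<open>Enriched P-partitions of a chain and peaks\<close>

text \<open>
  The number of compatible words of length \<open>n\<close> with letters at most \<open>v\<close>, where \<open>a i\<close> says that the
  step from position \<open>i\<close> to \<open>i + 1\<close> is an ascent (\<open>card_compatible\<close>).  In the last equation the final
  letter is either at most \<open>v\<close>, or equal to \<open>Suc v\<close>; in the latter case its predecessor may be
  \<open>Suc v\<close> as well exactly if the parity of \<open>Suc v\<close> allows a repetition at this step.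
\<close>

fun enriched_count :: "(nat \<Rightarrow> bool) \<Rightarrow> nat \<Rightarrow> nat \<Rightarrow> nat" where
  "enriched_count a 0 v = 1"
| "enriched_count a (Suc n) 0 = 0"
| "enriched_count a (Suc n) (Suc v) =
     enriched_count a (Suc n) v + enriched_count a n (if a n = even (Suc v) then Suc v else v)"

definition enriched_even :: "(nat \<Rightarrow> bool) \<Rightarrow> nat \<Rightarrow> rat fps" where
  "enriched_even a n = Abs_fps (\<lambda>k. of_nat (enriched_count a n (2 * k)))"

definition enriched_odd :: "(nat \<Rightarrow> bool) \<Rightarrow> nat \<Rightarrow> rat fps" where
  "enriched_odd a n = Abs_fps (\<lambda>k. of_nat (enriched_count a n (2 * k + 1)))"

definition cayley :: "rat fps" where
  "cayley = (1 + fps_X) * inverse (1 - fps_X)"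

definition peak_arg :: "rat fps" where
  "peak_arg = 4 * fps_X * inverse ((1 + fps_X)\<^sup>2)"

lemma cayley_mult: "cayley * (1 - fps_X) = 1 + fps_X"
  by (simp add: cayley_def mult.assoc inverse_mult_eq_1)

lemma peak_arg_mult: "peak_arg * (1 + fps_X)\<^sup>2 = 4 * fps_X"
  by (simp add: peak_arg_def mult.assoc inverse_mult_eq_1)

lemma one_plus_X_nonzero: "(1 + fps_X :: rat fps) \<noteq> 0"
  and one_minus_X_nonzero: "(1 - fps_X :: rat fps) \<noteq> 0"
  by (auto simp: fps_eq_iff intro!: exI[of _ 0])

lemma enriched_count_pos_zero: "n > 0 \<Longrightarrow> enriched_count a n 0 = 0"
  by (cases n) auto

lemma two_mult_nth: "(2 * f) $ k = 2 * (f $ k :: rat)"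
  by (metis fps_mult_left_const_nth numeral_fps_const)

text \<open>
  At an ascent the only new repetitions are those of even letters, so the words ending in \<open>2k + 1\<close> or
  \<open>2k + 2\<close> extend words bounded by \<open>2k\<close> and \<open>2k + 2\<close> respectively; at a descent both extend words
  bounded by \<open>2k + 1\<close>.  Step \<open>0\<close> precedes the first letter and constrains nothing; regarding it as a
  descent makes the recursion valid from the empty word on.
\<close>

lemma enriched_even_Suc:
  assumes "\<not> a 0"
  shows "(1 - fps_X) * enriched_even a (Suc n)
           = (if a n then (1 + fps_X) * enriched_even a n else 2 * (fps_X * enriched_odd a n))"
proof (rule fps_ext)
  fix k
  have "n > 0" if "a n" using that assms by (cases n) auto
  then show "((1 - fps_X) * enriched_even a (Suc n)) $ k
      = (if a n then (1 + fps_X) * enriched_even a n else 2 * (fps_X * enriched_odd a n)) $ k"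
    by (cases k) (auto simp: enriched_even_def enriched_odd_def algebra_simps enriched_count_pos_zero two_mult_nth)
qed

lemma enriched_odd_Suc:
  assumes "\<not> a 0"
  shows "(1 - fps_X) * enriched_odd a (Suc n)
           = (if a n then 2 * enriched_even a n else (1 + fps_X) * enriched_odd a n)"
proof (rule fps_ext)
  fix k
  have "n > 0" if "a n" using that assms by (cases n) auto
  then show "((1 - fps_X) * enriched_odd a (Suc n)) $ k
      = (if a n then 2 * enriched_even a n else (1 + fps_X) * enriched_odd a n) $ k"
    by (cases k) (auto simp: enriched_even_def enriched_odd_def algebra_simps enriched_count_pos_zero two_mult_nth)
qed

definition peaks :: "(nat \<Rightarrow> bool) \<Rightarrow> nat \<Rightarrow> nat" where
  "peaks a n = card {i. Suc i < n \<and> a i \<and> \<not> a (Suc i)}"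

lemma peaks_Suc_Suc:
  "peaks a (Suc (Suc n)) = peaks a (Suc n) + (if a n \<and> \<not> a (Suc n) then 1 else 0)"
proof -
  have "finite {i. Suc i < Suc n \<and> a i \<and> \<not> a (Suc i)}" by simp
  moreover have "{i. Suc i < Suc (Suc n) \<and> a i \<and> \<not> a (Suc i)}
      = (if a n \<and> \<not> a (Suc n) then insert n else id) {i. Suc i < Suc n \<and> a i \<and> \<not> a (Suc i)}"
    by (auto simp: less_Suc_eq)
  ultimately show ?thesis by (simp add: peaks_def)
qed

text \<open>
  After any step both series are multiples of one and the same series of the shorter chain, which
  fixes their ratio.
\<close>

lemma enriched_odd_vs_even:
  assumes "\<not> a 0"
  shows "(1 + fps_X) * (if a n then enriched_odd a (Suc n) else enriched_even a (Suc n))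
           = 2 * (if a n then enriched_even a (Suc n) else fps_X * enriched_odd a (Suc n))"
proof -
  have "(1 - fps_X) * ((1 + fps_X) * (if a n then enriched_odd a (Suc n) else enriched_even a (Suc n)))
      = (1 - fps_X) * (2 * (if a n then enriched_even a (Suc n) else fps_X * enriched_odd a (Suc n)))"
    using enriched_odd_Suc[of a n, OF assms] enriched_even_Suc[of a n, OF assms]
    by (cases "a n") (simp_all only: if_True if_False, algebra+)
  then show ?thesis using one_minus_X_nonzero by simp
qed

text \<open>
  Ascents multiply the even series by \<open>(1+s)/(1-s)\<close> and descents do the same to the odd series.  At a
  descent after a descent the ratio of the two series stays the same, and so the even series is
  multiplied by \<open>(1+s)/(1-s)\<close> again.  Only at a descent after an ascent, that is at a peak, does the
  ratio change, from \<open>2/(1+s)\<close> to \<open>(1+s)/2s\<close>, which costs a factor \<open>4s/(1+s)\<^sup>2\<close>.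
  The first such factor is there for a single letter already: its even series is \<open>2s/(1-s)\<^sup>2\<close>.
\<close>

lemma enriched_even_eq_peaks:
  assumes "\<not> a 0"
  shows "2 * enriched_even a (Suc n) = cayley ^ (Suc n + 1) * peak_arg ^ (peaks a (Suc n) + 1)"
proof -
  have four: "(4 :: rat fps) = 2 * 2" by simp
  show ?thesis
  proof (induction n)
    case 0
    let ?p = "1 + fps_X :: rat fps" and ?m = "1 - fps_X :: rat fps"
    have e: "?m * enriched_even a (Suc 0) = 2 * (fps_X * enriched_odd a 0)"
      using enriched_even_Suc[of a 0, OF assms] assms by simp
    have o: "?m * enriched_odd a 0 = 1"
      by (rule fps_ext, case_tac n) (simp_all add: enriched_odd_def algebra_simps)
    have "?m\<^sup>2 * ?p\<^sup>2 * (2 * enriched_even a (Suc 0)) = 2 * ?p\<^sup>2 * ?m * (?m * enriched_even a (Suc 0))"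
      by (simp only: power2_eq_square mult_ac)
    also have "\<dots> = ?p\<^sup>2 * (4 * fps_X) * (?m * enriched_odd a 0)"
      unfolding e by (simp only: four mult_ac)
    also have "\<dots> = (cayley * ?m)\<^sup>2 * (peak_arg * ?p\<^sup>2)"
      by (simp only: o cayley_mult peak_arg_mult mult_1_right)
    also have "\<dots> = ?m\<^sup>2 * ?p\<^sup>2 * (cayley\<^sup>2 * peak_arg)"
      by (simp only: power2_eq_square mult_ac)
    finally have "?m\<^sup>2 * ?p\<^sup>2 * (2 * enriched_even a (Suc 0)) = ?m\<^sup>2 * ?p\<^sup>2 * (cayley\<^sup>2 * peak_arg)" .
    then have "2 * enriched_even a (Suc 0) = cayley\<^sup>2 * peak_arg"
      using one_plus_X_nonzero one_minus_X_nonzero by simp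
    moreover have "peaks a (Suc 0) = 0" by (simp add: peaks_def)
    ultimately show ?case by (simp add: numeral_2_eq_2)
  next
    case (Suc n)
    let ?p = "1 + fps_X :: rat fps" and ?m = "1 - fps_X :: rat fps"
    note E = enriched_even_Suc[of a "Suc n", OF assms] and V = enriched_odd_vs_even[of a n, OF assms]
    have step: "enriched_even a (Suc (Suc n))
        = cayley * (if a n \<and> \<not> a (Suc n) then peak_arg else 1) * enriched_even a (Suc n)"
    proof (cases "a n \<and> \<not> a (Suc n)")
      case True
      have "?m * ?p\<^sup>2 * enriched_even a (Suc (Suc n)) = ?p\<^sup>2 * (?m * enriched_even a (Suc (Suc n)))"
        by (simp only: mult_ac)
      also have "?m * enriched_even a (Suc (Suc n)) = 2 * (fps_X * enriched_odd a (Suc n))"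
        using E True by simp
      also have "?p\<^sup>2 * \<dots> = 2 * fps_X * ?p * (?p * enriched_odd a (Suc n))"
        by (simp only: power2_eq_square mult_ac)
      also have "?p * enriched_odd a (Suc n) = 2 * enriched_even a (Suc n)"
        using V True by simp
      also have "2 * fps_X * ?p * \<dots> = ?p * (4 * fps_X) * enriched_even a (Suc n)"
        by (simp only: four mult_ac)
      also have "\<dots> = (cayley * ?m) * (peak_arg * ?p\<^sup>2) * enriched_even a (Suc n)"
        by (simp only: cayley_mult peak_arg_mult)
      also have "\<dots> = ?m * ?p\<^sup>2 * (cayley * peak_arg * enriched_even a (Suc n))"
        by (simp only: mult_ac)
      finally show ?thesis
        using True one_plus_X_nonzero one_minus_X_nonzero by simp
    next
      case False
      have "?m * enriched_even a (Suc (Suc n)) = ?p * enriched_even a (Suc n)"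
        using E V False by (cases "a (Suc n)") auto
      also have "\<dots> = ?m * (cayley * enriched_even a (Suc n))"
        by (simp only: cayley_mult[symmetric] mult_ac)
      finally show ?thesis
        using False one_minus_X_nonzero by auto
    qed
    have "2 * enriched_even a (Suc (Suc n))
        = cayley * (if a n \<and> \<not> a (Suc n) then peak_arg else 1) * (2 * enriched_even a (Suc n))"
      using step by (simp only: mult_ac)
    also have "\<dots> = cayley ^ (Suc (Suc n) + 1) * peak_arg ^ (peaks a (Suc (Suc n)) + 1)"
      unfolding Suc.IH by (simp add: peaks_Suc_Suc)
    finally show ?case .
  qed
qed

text \<open>Position \<open>0\<close> is declared a descent, as the recursions above require.\<close>

definition ascent :: "(nat \<Rightarrow> nat) \<Rightarrow> nat \<Rightarrow> bool" where
  "ascent p i \<longleftrightarrow> 0 < i \<and> p i < p (Suc i)"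

lemma pk_eq_peaks:
  assumes "p permutes {1..n}"
  shows "pk n p = peaks (ascent p) n"
proof -
  have "{i. 2 \<le> i \<and> i \<le> n - 1 \<and> p (i - 1) < p i \<and> p i > p (i + 1)}
      = Suc ` {i. Suc i < n \<and> ascent p i \<and> \<not> ascent p (Suc i)}" (is "?L = _ ` ?R")
  proof (rule equalityI; rule subsetI)
    fix i assume "i \<in> ?L"
    then have "i - 1 \<in> ?R" "i = Suc (i - 1)" by (auto simp: ascent_def)
    then show "i \<in> Suc ` ?R" by blast
  next
    fix j assume "j \<in> Suc ` ?R"
    then obtain i where "j = Suc i" "i \<in> ?R" by blast
    moreover have "p (Suc i) \<noteq> p (Suc (Suc i))"
      using permutes_inj[OF assms] by (metis injD n_not_Suc_n)
    ultimately show "j \<in> ?L" by (auto simp: ascent_def)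
  qed
  then show ?thesis by (simp add: pk_def peaks_def card_image)
qed

section \<open>Compatible words\<close>

abbreviation words :: "nat \<Rightarrow> nat \<Rightarrow> (nat \<Rightarrow> nat) set" where
  "words n L \<equiv> {1..n} \<rightarrow>\<^sub>E {1..L}"

lemma finite_words: "finite (words n L)"
  by (simp add: finite_PiE)

lemma words_last: "n = 0 \<or> w n \<in> {1..L}" if "w \<in> words n L"
  using PiE_mem[OF that, of n] by (cases "n = 0") simp_all

lemma sum_words_Suc:
  "(\<Sum>w\<in>words (Suc n) L. F w) = (\<Sum>w\<in>words n L. \<Sum>v=1..L. F (w(Suc n := v)))"
proof -
  have n: "{1..Suc n} = insert (Suc n) {1..n}" by auto
  have "(\<Sum>w\<in>words (Suc n) L. F w)
      = sum F ((\<lambda>(v, w). w(Suc n := v)) ` ({1..L} \<times> words n L))"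
    by (simp only: n PiE_insert_eq)
  also have "\<dots> = sum (F \<circ> (\<lambda>(v, w). w(Suc n := v))) ({1..L} \<times> words n L)"
    by (rule sum.reindex, rule inj_combinator) simp
  also have "\<dots> = (\<Sum>v=1..L. \<Sum>w\<in>words n L. F (w(Suc n := v)))"
    by (simp only: sum.cartesian_product comp_def case_prod_unfold)
  also have "\<dots> = (\<Sum>w\<in>words n L. \<Sum>v=1..L. F (w(Suc n := v)))"
    by (rule sum.swap)
  finally show ?thesis .
qed

lemma enriched_count_cong: "(\<And>i. i < n \<Longrightarrow> a i = b i) \<Longrightarrow> enriched_count a n v = enriched_count b n v"
proof (induction a n v rule: enriched_count.induct)
  case (3 a n v)
  have "a n = b n" using "3.prems" by simp
  moreover have "enriched_count a (Suc n) v = enriched_count b (Suc n) v" using "3.IH"(1) "3.prems" by blast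
  moreover have "enriched_count a n u = enriched_count b n u" if "u = (if a n = even (Suc v) then Suc v else v)" for u
    unfolding that using "3.IH"(2) "3.prems" less_Suc_eq by blast
  ultimately show ?case by simp
qed simp_all

definition compatible :: "(nat \<Rightarrow> bool) \<Rightarrow> nat \<Rightarrow> (nat \<Rightarrow> nat) \<Rightarrow> bool" where
  "compatible a n g \<longleftrightarrow>
     (\<forall>i. 0 < i \<and> i < n \<longrightarrow> g i < g (Suc i) \<or> (g i = g (Suc i) \<and> a i = even (g i)))"

lemma compatible_cong:
  assumes "\<And>i. i \<in> {1..n} \<Longrightarrow> f i = g i"
  shows "compatible a n f = compatible a n g"
proof -
  have "f i = g i" "f (Suc i) = g (Suc i)" if "0 < i \<and> i < n" for i
    using that assms[of i] assms[of "Suc i"] by simp_all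
  then show ?thesis unfolding compatible_def by simp
qed

lemma compatible_upd:
  "compatible a (Suc n) (g(Suc n := u)) \<longleftrightarrow>
     compatible a n g \<and> (n = 0 \<or> g n < u \<or> (g n = u \<and> a n = even u))"
proof -
  have all_Suc: "(\<forall>i. 0 < i \<and> i < Suc n \<longrightarrow> P i) \<longleftrightarrow> (\<forall>i. 0 < i \<and> i < n \<longrightarrow> P i) \<and> (n = 0 \<or> P n)" for P
    by (metis less_Suc_eq gr0I)
  have "compatible a (Suc n) h \<longleftrightarrow> compatible a n h \<and>
      (n = 0 \<or> h n < h (Suc n) \<or> (h n = h (Suc n) \<and> a n = even (h n)))" for h
    using all_Suc[of "\<lambda>i. h i < h (Suc i) \<or> (h i = h (Suc i) \<and> a i = even (h i))"]
    unfolding compatible_def .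
  moreover have "compatible a n (g(Suc n := u)) = compatible a n g"
    by (rule compatible_cong) simp
  ultimately show ?thesis by auto
qed

text \<open>
  Bounding the last letter only (rather than all of them) turns the removal of the last letter into
  the recursion of \<open>enriched_count\<close>; the other letters are bounded by it anyway.
\<close>

lemma sum_compatible_bounded:
  assumes "v \<le> L"
  shows "(\<Sum>g\<in>words n L. of_bool (compatible a n g \<and> (n = 0 \<or> g n \<le> v))) = enriched_count a n v"
  using assms
proof (induction a n v rule: enriched_count.induct)
  case (1 a v)
  show ?case by (simp add: compatible_def)
next
  case (2 a n)
  have "(\<Sum>g\<in>words (Suc n) L.
      of_bool (compatible a (Suc n) g \<and> (Suc n = 0 \<or> g (Suc n) \<le> 0)) :: nat) = 0"
  proof (intro sum.neutral ballI)
    fix g assume "g \<in> words (Suc n) L"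
    then have "g (Suc n) > 0" using words_last[of g "Suc n" L] by simp
    then show "of_bool (compatible a (Suc n) g \<and> (Suc n = 0 \<or> g (Suc n) \<le> 0)) = (0 :: nat)"
      by simp
  qed
  then show ?case by simp
next
  case (3 a n v)
  let ?c = "\<lambda>g u. compatible a (Suc n) (g(Suc n := u))"
  let ?v' = "if a n = even (Suc v) then Suc v else v"
  have split: "of_bool (?c g u \<and> u \<le> Suc v)
      = of_bool (?c g u \<and> u \<le> v) + (if u = Suc v then of_bool (?c g (Suc v)) else 0 :: nat)" for g u
    by (auto simp: le_Suc_eq)
  have "(\<Sum>g\<in>words (Suc n) L. of_bool (compatible a (Suc n) g \<and> (Suc n = 0 \<or> g (Suc n) \<le> Suc v)))
      = (\<Sum>g\<in>words n L. \<Sum>u=1..L. of_bool (?c g u \<and> u \<le> Suc v) :: nat)"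
    unfolding sum_words_Suc by simp
  also have "\<dots> = (\<Sum>g\<in>words n L. \<Sum>u=1..L. of_bool (?c g u \<and> u \<le> v))
      + (\<Sum>g\<in>words n L. of_bool (?c g (Suc v)))"
    using "3.prems" by (simp only: split sum.distrib) (simp add: sum.delta)
  also have "(\<Sum>g\<in>words n L. \<Sum>u=1..L. of_bool (?c g u \<and> u \<le> v)) = enriched_count a (Suc n) v"
    using "3.IH"(1) "3.prems" unfolding sum_words_Suc by simp
  also have "(\<Sum>g\<in>words n L. of_bool (?c g (Suc v)))
      = (\<Sum>g\<in>words n L. of_bool (compatible a n g \<and> (n = 0 \<or> g n \<le> ?v')) :: nat)"
    by (intro sum.cong refl arg_cong[where f = of_bool]) (auto simp: compatible_upd)
  also have "\<dots> = enriched_count a n ?v'"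
    using "3.IH"(2) "3.prems" by simp
  finally show ?case by simp
qed

lemma card_compatible: "card {g \<in> words n L. compatible a n g} = enriched_count a n L"
proof -
  have "card {g \<in> words n L. compatible a n g} = (\<Sum>g\<in>words n L. of_bool (compatible a n g))"
    by (simp only: card_eq_sum sum.inter_filter[OF finite_words] of_bool_def)
  also have "\<dots> = (\<Sum>g\<in>words n L. of_bool (compatible a n g \<and> (n = 0 \<or> g n \<le> L)))"
    using words_last by (intro sum.cong refl arg_cong[where f = of_bool]) (meson atLeastAtMost_iff)
  finally show ?thesis using sum_compatible_bounded[of L L a n] by simp
qed

section \<open>Standardization of words\<close>

text \<open>
  The ascents of the permutation that standardizes \<open>w\<close>: equal even letters count as increasing from
  left to right, equal odd letters as decreasing.
\<close>

definition word_ascent :: "(nat \<Rightarrow> nat) \<Rightarrow> nat \<Rightarrow> bool" where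
  "word_ascent w i \<longleftrightarrow> 0 < i \<and> (w i < w (Suc i) \<or> (w i = w (Suc i) \<and> even (w i)))"

text \<open>
  Sorting positions by this number means sorting them by their letters, with ties broken from left to
  right for even letters and from right to left for odd ones.  The tie breaker is at most \<open>n\<close>, so it
  never outweighs the factor \<open>Suc n\<close> of the letter.
\<close>

definition std_key :: "nat \<Rightarrow> (nat \<Rightarrow> nat) \<Rightarrow> nat \<Rightarrow> nat" where
  "std_key n w i = w i * Suc n + (if even (w i) then i else n - i)"

lemma std_key_less_iff:
  assumes "i \<le> n" "j \<le> n"
  shows "std_key n w i < std_key n w j \<longleftrightarrow>
           w i < w j \<or> (w i = w j \<and> (if even (w i) then i < j else j < i))"
proof -
  have *: "std_key n w i < std_key n w j" if "w i < w j" "i \<le> n" for i j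
  proof -
    have "std_key n w i < Suc (w i) * Suc n" using that by (auto simp: std_key_def)
    also have "\<dots> \<le> w j * Suc n" using that by (intro mult_le_mono1) auto
    also have "\<dots> \<le> std_key n w j" by (simp add: std_key_def)
    finally show ?thesis .
  qed
  consider "w i < w j" | "w j < w i" | "w i = w j" by linarith
  then show ?thesis
    by cases (use assms *[of i j] *[of j i] in \<open>auto simp: std_key_def\<close>)
qed

lemma inj_std_key: "inj_on (std_key n w) {..n}"
proof (rule inj_onI)
  fix i j assume "i \<in> {..n}" "j \<in> {..n}" "std_key n w i = std_key n w j"
  then show "i = j"
    using std_key_less_iff[of i n j w] std_key_less_iff[of j n i w] by (auto split: if_splits)
qed

text \<open>Outside \<open>{1..n}\<close> the rank is replaced by the identity, so that \<open>permutes\<close> applies.\<close>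

definition standardize :: "nat \<Rightarrow> (nat \<Rightarrow> nat) \<Rightarrow> nat \<Rightarrow> nat" where
  "standardize n w i = (if i \<in> {1..n} then card {j \<in> {1..n}. std_key n w j \<le> std_key n w i} else i)"

lemma standardize_less_iff:
  assumes "i \<in> {1..n}" "j \<in> {1..n}"
  shows "standardize n w i < standardize n w j \<longleftrightarrow> std_key n w i < std_key n w j"
proof -
  have *: "standardize n w i < standardize n w j" if "std_key n w i < std_key n w j"
      "i \<in> {1..n}" "j \<in> {1..n}" for i j
  proof -
    let ?S = "\<lambda>i. {j \<in> {1..n}. std_key n w j \<le> std_key n w i}"
    have "j \<in> ?S j" "j \<notin> ?S i" "?S i \<subseteq> ?S j" using that by auto
    then have "?S i \<subset> ?S j" by blast
    then have "card (?S i) < card (?S j)" by (intro psubset_card_mono) auto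
    then show ?thesis using that by (simp add: standardize_def)
  qed
  consider "std_key n w i < std_key n w j" | "std_key n w j < std_key n w i" | "i = j"
    using inj_onD[OF inj_std_key, of n w i j] assms by force
  then show ?thesis
  proof cases
    case 1
    then show ?thesis using *[OF _ assms] by blast
  next
    case 2
    then show ?thesis using *[OF _ assms(2,1)] by (meson less_asym)
  qed simp
qed

lemma standardize_permutes: "standardize n w permutes {1..n}"
proof (rule bij_imp_permutes)
  have inj: "inj_on (standardize n w) {1..n}"
  proof (rule inj_onI)
    fix i j assume ij: "i \<in> {1..n}" "j \<in> {1..n}" "standardize n w i = standardize n w j"
    then have "std_key n w i = std_key n w j"
      using standardize_less_iff[of i n j w] standardize_less_iff[of j n i w] by auto
    then show "i = j" using ij inj_onD[OF inj_std_key] by simp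
  qed
  have "standardize n w ` {1..n} \<subseteq> {1..n}"
  proof
    fix k assume "k \<in> standardize n w ` {1..n}"
    then obtain i where i: "i \<in> {1..n}" "k = card {j \<in> {1..n}. std_key n w j \<le> std_key n w i}"
      by (auto simp: standardize_def)
    let ?S = "{j \<in> {1..n}. std_key n w j \<le> std_key n w i}"
    have "card ?S \<le> card {1..n}" by (intro card_mono) auto
    moreover have "card ?S > 0" using i(1) by (subst card_gt_0_iff) auto
    ultimately show "k \<in> {1..n}" using i by simp
  qed
  then show "bij_betw (standardize n w) {1..n} {1..n}"
    using inj by (simp add: bij_betw_def endo_inj_surj)
qed (auto simp: standardize_def)

lemma ascent_standardize:
  assumes "i < n"
  shows "ascent (standardize n w) i = word_ascent w i"
proof (cases "i = 0")
  case False
  then show ?thesis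
    using assms by (auto simp: ascent_def word_ascent_def standardize_less_iff std_key_less_iff)
qed (simp add: ascent_def word_ascent_def)

text \<open>
  Compatibility of \<open>w \<circ> inv p\<close> with \<open>inv p\<close> says that \<open>inv p\<close> lists the positions of \<open>w\<close> in increasing
  order of their keys.  This is what makes the standardization exist and be unique.
\<close>

lemma compatible_inv_iff:
  assumes p: "p permutes {1..n}"
  shows "compatible (ascent (inv p)) n (w \<circ> inv p) \<longleftrightarrow>
    (\<forall>i. 0 < i \<and> i < n \<longrightarrow> std_key n w (inv p i) < std_key n w (inv p (Suc i)))"
proof -
  have "(w (inv p i) < w (inv p (Suc i)) \<or>
        (w (inv p i) = w (inv p (Suc i)) \<and> ascent (inv p) i = even (w (inv p i))))
      \<longleftrightarrow> std_key n w (inv p i) < std_key n w (inv p (Suc i))" if "0 < i" "i < n" for i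
  proof -
    have "inv p i \<in> {1..n}" "inv p (Suc i) \<in> {1..n}"
      using that permutes_in_image[OF permutes_inv[OF p]] by auto
    moreover have "inv p i \<noteq> inv p (Suc i)"
      using permutes_inj[OF permutes_inv[OF p]] by (metis injD n_not_Suc_n)
    ultimately show ?thesis using that by (auto simp: std_key_less_iff ascent_def)
  qed
  then show ?thesis unfolding compatible_def by auto
qed

lemma compatible_standardize: "compatible (ascent (inv (standardize n w))) n (w \<circ> inv (standardize n w))"
  unfolding compatible_inv_iff[OF standardize_permutes]
proof (intro allI impI)
  fix i assume i: "0 < i \<and> i < n"
  then have "inv (standardize n w) i \<in> {1..n}" "inv (standardize n w) (Suc i) \<in> {1..n}"
    using permutes_in_image[OF permutes_inv[OF standardize_permutes]] by auto
  then show "std_key n w (inv (standardize n w) i) < std_key n w (inv (standardize n w) (Suc i))"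
    by (simp add: standardize_less_iff[symmetric] permutes_inverses[OF standardize_permutes])
qed

lemma standardize_unique:
  assumes p: "p permutes {1..n}" and "compatible (ascent (inv p)) n (w \<circ> inv p)"
  shows "standardize n w = p"
proof
  have step: "std_key n w (inv p i) < std_key n w (inv p (Suc i))" if "0 < i" "i < n" for i
    using assms that compatible_inv_iff[OF p] by blast
  have mono: "0 < i \<Longrightarrow> j \<le> n \<Longrightarrow> std_key n w (inv p i) < std_key n w (inv p j)"
    if "i < j" for i j
    using that
  proof (induction rule: less_Suc_induct)
    case (1 i) then show ?case using step by simp
  next
    case (2 i j k) then show ?case by force
  qed
  note inv = permutes_inverses[OF p] and img = permutes_in_image[OF p]
    and img' = permutes_in_image[OF permutes_inv[OF p]]
  fix i
  show "standardize n w i = p i"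
  proof (cases "i \<in> {1..n}")
    case True
    then have pi: "p i \<in> {1..n}" using img by blast
    have "{j \<in> {1..n}. std_key n w j \<le> std_key n w i} = inv p ` {1..p i}"
    proof (intro equalityI subsetI)
      fix j assume j: "j \<in> {j \<in> {1..n}. std_key n w j \<le> std_key n w i}"
      then have "p j \<in> {1..n}" using img by blast
      moreover have "p j \<le> p i"
        using mono[of "p i" "p j"] j pi \<open>p j \<in> {1..n}\<close> by (force simp: inv)
      ultimately show "j \<in> inv p ` {1..p i}"
        by (intro image_eqI[of _ _ "p j"]) (auto simp: inv)
    next
      fix j assume "j \<in> inv p ` {1..p i}"
      then obtain k where k: "j = inv p k" "k \<in> {1..p i}" by blast
      then have "k \<in> {1..n}" using pi by auto
      then have "j \<in> {1..n}" unfolding k(1) using img' by blast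
      have "std_key n w j \<le> std_key n w (inv p (p i))"
      proof (cases "k = p i")
        case False
        then show ?thesis unfolding k(1) using mono[of k "p i"] k(2) pi by simp
      qed (simp add: k(1))
      then show "j \<in> {j \<in> {1..n}. std_key n w j \<le> std_key n w i}"
        using \<open>j \<in> {1..n}\<close> by (simp add: inv)
    qed
    then have "standardize n w i = card (inv p ` {1..p i})"
      using True by (simp only: standardize_def if_True)
    also have "\<dots> = card {1..p i}"
      by (intro card_image inj_on_subset[OF permutes_inj[OF permutes_inv[OF p]]]) simp
    finally show ?thesis by simp
  next
    case False
    then show ?thesis using permutes_not_in[OF p] by (auto simp: standardize_def)
  qed
qed

text \<open>
  The bijection sends a permutation \<open>p\<close> and a word \<open>g\<close> compatible with its inverse to \<open>g \<circ> p\<close>; the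
  permutation is recovered as the standardization of this word.
\<close>

lemma sum_standardization:
  fixes F :: "(nat \<Rightarrow> nat) \<Rightarrow> 'a :: comm_semiring_1"
  shows "(\<Sum>p | p permutes {1..n}. of_nat (enriched_count (ascent (inv p)) n L) * F p)
           = (\<Sum>w\<in>words n L. F (standardize n w))"
proof -
  let ?P = "{p. p permutes {1..n}}"
  let ?C = "\<lambda>p. {g \<in> words n L. compatible (ascent (inv p)) n g}"
  have fin: "finite (?C p)" for p
    by (rule finite_subset[OF _ finite_words]) blast
  have words_restrict: "restrict (w \<circ> q) {1..n} \<in> words n L"
    if "w \<in> words n L" "q permutes {1..n}" for w q
  proof (rule restrict_PiE_iff[THEN iffD2], rule ballI)
    fix i assume "i \<in> {1..n}"
    then have "q i \<in> {1..n}" using permutes_in_image[OF that(2)] by blast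
    then show "(w \<circ> q) i \<in> {1..L}" unfolding comp_apply using that(1) by (rule PiE_mem[rotated])
  qed
  have restrict_twice: "restrict (restrict (w \<circ> p) {1..n} \<circ> q) {1..n} = w"
    if "w \<in> words n L" "q permutes {1..n}" "\<And>i. p (q i) = i" for w p q
  proof
    fix i
    show "restrict (restrict (w \<circ> p) {1..n} \<circ> q) {1..n} i = w i"
    proof (cases "i \<in> {1..n}")
      case True
      then have "q i \<in> {1..n}" using permutes_in_image[OF that(2)] by blast
      then show ?thesis using True by (simp only: restrict_apply if_True comp_apply that(3))
    next
      case False
      then show ?thesis using PiE_arb[OF that(1) False] by (simp only: restrict_apply if_False)
    qed
  qed
  have "(\<Sum>p\<in>?P. of_nat (enriched_count (ascent (inv p)) n L) * F p) = (\<Sum>p\<in>?P. \<Sum>g\<in>?C p. F p)"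
    by (simp only: sum_constant card_compatible)
  also have "\<dots> = (\<Sum>(p, g)\<in>Sigma ?P ?C. F p)"
    by (rule sum.Sigma, rule finite_permutations, simp, intro ballI fin)
  also have "\<dots> = (\<Sum>w\<in>words n L. F (standardize n w))"
  proof (rule sum.reindex_bij_witness[where
        j = "\<lambda>(p, g). restrict (g \<circ> p) {1..n}" and
        i = "\<lambda>w. (standardize n w, restrict (w \<circ> inv (standardize n w)) {1..n})"])
    fix x assume "x \<in> Sigma ?P ?C"
    then obtain p g where x: "x = (p, g)" and p: "p permutes {1..n}"
      and g: "g \<in> words n L" and c: "compatible (ascent (inv p)) n g" by auto
    let ?w = "restrict (g \<circ> p) {1..n}"
    have "(?w \<circ> inv p) i = g i" if "i \<in> {1..n}" for i
    proof -
      have "inv p i \<in> {1..n}" using that permutes_in_image[OF permutes_inv[OF p]] by blast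
      then show ?thesis by (simp only: restrict_apply if_True comp_apply permutes_inverses[OF p])
    qed
    then have "compatible (ascent (inv p)) n (?w \<circ> inv p)"
      using c compatible_cong[of n "?w \<circ> inv p" g] by blast
    then have standardize: "standardize n ?w = p" by (rule standardize_unique[OF p])
    have "restrict (?w \<circ> inv p) {1..n} = g"
      by (rule restrict_twice[OF g permutes_inv[OF p]]) (simp add: permutes_inverses[OF p])
    then show "(case x of (p, g) \<Rightarrow> restrict (g \<circ> p) {1..n}) \<in> words n L"
      and "(\<lambda>w. (standardize n w, restrict (w \<circ> inv (standardize n w)) {1..n}))
              (case x of (p, g) \<Rightarrow> restrict (g \<circ> p) {1..n}) = x"
      and "F (standardize n (case x of (p, g) \<Rightarrow> restrict (g \<circ> p) {1..n})) = (case x of (p, g) \<Rightarrow> F p)"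
      using standardize words_restrict[OF g p] by (simp_all only: x prod.case)
  next
    fix w assume w: "w \<in> words n L"
    let ?p = "standardize n w"
    have "compatible (ascent (inv ?p)) n (restrict (w \<circ> inv ?p) {1..n})"
      by (rule compatible_cong[THEN iffD2, OF _ compatible_standardize]) (simp only: restrict_apply if_True)
    then show "(?p, restrict (w \<circ> inv ?p) {1..n}) \<in> Sigma ?P ?C"
      using words_restrict[OF w permutes_inv[OF standardize_permutes]] standardize_permutes by blast
    show "(case (?p, restrict (w \<circ> inv ?p) {1..n}) of (p, g) \<Rightarrow> restrict (g \<circ> p) {1..n}) = w"
      unfolding prod.case
      using w standardize_permutes permutes_inverses(2)[OF standardize_permutes] by (rule restrict_twice)
  qed
  finally show ?thesis .
qed

lemma sum_enriched_counts_eq_sum_words: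
  "(\<Sum>p | p permutes {1..n}. enriched_count (ascent p) n K * enriched_count (ascent (inv p)) n L)
     = (\<Sum>w\<in>words n L. enriched_count (word_ascent w) n K)"
proof -
  have "(\<Sum>p | p permutes {1..n}. enriched_count (ascent p) n K * enriched_count (ascent (inv p)) n L)
      = (\<Sum>w\<in>words n L. enriched_count (ascent (standardize n w)) n K)"
    using sum_standardization[of n L "\<lambda>p. enriched_count (ascent p) n K"] by (simp only: mult.commute of_nat_id)
  also have "\<dots> = (\<Sum>w\<in>words n L. enriched_count (word_ascent w) n K)"
    by (intro sum.cong refl enriched_count_cong ascent_standardize)
  finally show ?thesis .
qed

section \<open>Counting pairs of words\<close>

text \<open>
  Counts pairs consisting of a word \<open>w\<close> and a word compatible with its ascents whose last letter is at
  most \<open>K\<close>, or equal to \<open>Suc K\<close> provided that \<open>w\<close> ends in a letter from \<open>Z\<close>.  Enlarging \<open>Z\<close> from the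
  empty set to \<open>{1..L}\<close> letter by letter interpolates between the bounds \<open>K\<close> and \<open>Suc K\<close>: the pairs
  \<open>(Suc K, v)\<close> become available as last pair one after the other.
  The empty word has no last letter, but its count is \<open>1\<close> for either bound.
\<close>

definition word_count :: "nat \<Rightarrow> nat set \<Rightarrow> nat \<Rightarrow> nat \<Rightarrow> nat" where
  "word_count L Z K n = (\<Sum>w\<in>words n L. enriched_count (word_ascent w) n (if w n \<in> Z then Suc K else K))"

text \<open>
  The assumption on \<open>Z\<close> says that the letters are added in the right order: a last pair \<open>(Suc K, v)\<close>
  may follow \<open>(Suc K, u)\<close> exactly for those \<open>u\<close> that have been added before \<open>v\<close>, and for \<open>u = v\<close> if
  the pair is repeatable, which is what \<open>r\<close> records.  The pairs that become available by adding \<open>v\<close>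
  are then counted by deleting the last pair.
\<close>

lemma word_count_insert:
  assumes "v \<in> {1..L}" "v \<notin> Z"
    and Z: "\<And>u. u \<in> {1..L} \<Longrightarrow>
      ((u < v \<or> (u = v \<and> even u)) = even (Suc K)) \<longleftrightarrow> u \<in> (if r then insert v Z else Z)"
  shows "word_count L (insert v Z) K (Suc n)
           = word_count L Z K (Suc n) + word_count L (if r then insert v Z else Z) K n"
proof -
  have "(\<Sum>u=1..L. enriched_count (word_ascent (w(Suc n := u))) (Suc n) (if u \<in> insert v Z then Suc K else K))
      = (\<Sum>u=1..L. enriched_count (word_ascent (w(Suc n := u))) (Suc n) (if u \<in> Z then Suc K else K))
        + enriched_count (word_ascent w) n (if w n \<in> (if r then insert v Z else Z) then Suc K else K)"
    (is "?A = ?B + ?C") if w: "w \<in> words n L" for w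
  proof -
    let ?a = "word_ascent (w(Suc n := v))"
    let ?K = "if ?a n = even (Suc K) then Suc K else K"
    have "?A = (\<Sum>u=1..L. enriched_count (word_ascent (w(Suc n := u))) (Suc n) (if u \<in> Z then Suc K else K)
        + (if u = v then enriched_count ?a n ?K else 0))"
      using assms(2) by (intro sum.cong refl) auto
    also have "\<dots> = ?B + enriched_count ?a n ?K"
      using assms(1) by (simp add: sum.distrib sum.delta)
    also have "enriched_count ?a n ?K = enriched_count (word_ascent w) n ?K"
      by (rule enriched_count_cong) (auto simp: word_ascent_def)
    also have "\<dots> = ?C"
    proof (cases n)
      case (Suc m)
      then have "w n \<in> {1..L}" using words_last[OF w] by simp
      then show ?thesis using Z[of "w n"] Suc by (simp add: word_ascent_def)
    qed simp
    finally show ?thesis .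
  qed
  then show ?thesis
    unfolding word_count_def sum_words_Suc fun_upd_same sum.distrib[symmetric]
    by (rule sum.cong[OF refl])
qed

definition word_gf :: "nat \<Rightarrow> nat set \<Rightarrow> nat \<Rightarrow> rat fps" where
  "word_gf L Z K = Abs_fps (\<lambda>n. of_nat (word_count L Z K n))"

lemma word_gf_insert:
  assumes "v \<in> {1..L}" "v \<notin> Z"
    and Z: "\<And>u. u \<in> {1..L} \<Longrightarrow>
      ((u < v \<or> (u = v \<and> even u)) = even (Suc K)) \<longleftrightarrow> u \<in> (if r then insert v Z else Z)"
  shows "word_gf L (insert v Z) K
           = word_gf L Z K + fps_X * word_gf L (if r then insert v Z else Z) K"
proof (rule fps_ext)
  fix n
  show "word_gf L (insert v Z) K $ n
      = (word_gf L Z K + fps_X * word_gf L (if r then insert v Z else Z) K) $ n"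
  proof (cases n)
    case 0
    then show ?thesis by (simp add: word_gf_def word_count_def)
  next
    case (Suc m)
    then show ?thesis using word_count_insert[OF assms, of m] by (simp add: word_gf_def)
  qed
qed

text \<open>
  For even \<open>Suc K\<close> the letters have to be added in increasing order, and the even ones are repeatable:
  an odd letter contributes \<open>1 + x\<close> and the even letter after it \<open>1/(1-x)\<close>.
\<close>

lemma word_gf_step_even:
  assumes "even (Suc K)" "j < l"
  shows "word_gf (2 * l) {1..2 * Suc j} K = cayley * word_gf (2 * l) {1..2 * j} K"
proof -
  let ?F = "\<lambda>Z. word_gf (2 * l) Z K"
  have s: "{1..2 * Suc j} = insert (2 * j + 2) {1..2 * j + 1}" "{1..2 * j + 1} = insert (2 * j + 1) {1..2 * j}"
    by auto
  have 1: "?F (insert (2 * j + 1) {1..2 * j}) = ?F {1..2 * j} + fps_X * ?F {1..2 * j}"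
    using word_gf_insert[where v = "2 * j + 1" and Z = "{1..2 * j}" and r = False and L = "2 * l" and K = K]
      assms by force
  have 2: "?F (insert (2 * j + 2) {1..2 * j + 1})
      = ?F {1..2 * j + 1} + fps_X * ?F (insert (2 * j + 2) {1..2 * j + 1})"
    using word_gf_insert[where v = "2 * j + 2" and Z = "{1..2 * j + 1}" and r = True and L = "2 * l" and K = K]
      assms by force
  have "(1 - fps_X) * ?F {1..2 * Suc j} = (1 - fps_X) * (cayley * ?F {1..2 * j})"
    using 1 2 cayley_mult unfolding s by algebra
  then show ?thesis using one_minus_X_nonzero by simp
qed

text \<open>
  For odd \<open>Suc K\<close> equal letters go with descents, so the letters have to be added in decreasing order,
  and now the odd ones are repeatable.
\<close>

lemma word_gf_step_odd:
  assumes "odd (Suc K)" "j < l"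
  shows "word_gf (2 * l) {2 * j<..2 * l} K = cayley * word_gf (2 * l) {2 * Suc j<..2 * l} K"
proof -
  let ?F = "\<lambda>Z. word_gf (2 * l) Z K"
  have s: "{2 * j<..2 * l} = insert (2 * j + 1) {2 * j + 1<..2 * l}"
    "{2 * j + 1<..2 * l} = insert (2 * j + 2) {2 * Suc j<..2 * l}"
    using assms by auto
  have 1: "?F (insert (2 * j + 2) {2 * Suc j<..2 * l})
      = ?F {2 * Suc j<..2 * l} + fps_X * ?F {2 * Suc j<..2 * l}"
    using word_gf_insert[where v = "2 * j + 2" and Z = "{2 * Suc j<..2 * l}" and r = False and L = "2 * l" and K = K]
      assms by force
  have 2: "?F (insert (2 * j + 1) {2 * j + 1<..2 * l})
      = ?F {2 * j + 1<..2 * l} + fps_X * ?F (insert (2 * j + 1) {2 * j + 1<..2 * l})"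
    using word_gf_insert[where v = "2 * j + 1" and Z = "{2 * j + 1<..2 * l}" and r = True and L = "2 * l" and K = K]
      assms by force
  have "(1 - fps_X) * ?F {2 * j<..2 * l} = (1 - fps_X) * (cayley * ?F {2 * Suc j<..2 * l})"
    using 1 2 cayley_mult unfolding s by algebra
  then show ?thesis using one_minus_X_nonzero by simp
qed

lemma word_gf_all: "word_gf L {1..L} K = word_gf L {} (Suc K)"
proof -
  have "enriched_count (word_ascent w) n (if w n \<in> {1..L} then Suc K else K) = enriched_count (word_ascent w) n (Suc K)"
    if "w \<in> words n L" for w n
    using words_last[OF that] by (cases n) auto
  then show ?thesis by (simp add: word_gf_def word_count_def)
qed

lemma word_gf_Suc: "word_gf (2 * l) {} (Suc K) = cayley ^ l * word_gf (2 * l) {} K"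
proof (cases "even (Suc K)")
  case True
  have "j \<le> l \<Longrightarrow> word_gf (2 * l) {1..2 * j} K = cayley ^ j * word_gf (2 * l) {} K" for j
    using word_gf_step_even[OF True] by (induction j) (simp_all add: mult.assoc)
  then show ?thesis using word_gf_all[of "2 * l" K] by (metis le_refl)
next
  case False
  have "j \<le> l \<Longrightarrow> word_gf (2 * l) {2 * (l - j)<..2 * l} K = cayley ^ j * word_gf (2 * l) {} K" for j
  proof (induction j)
    case (Suc j)
    then have "Suc (l - Suc j) = l - j" by simp
    then show ?case using Suc word_gf_step_odd[OF False, of "l - Suc j" l] by (simp add: mult.assoc)
  qed simp
  moreover have "{0<..2 * l} = {1..2 * l}" by auto
  ultimately show ?thesis using word_gf_all[of "2 * l" K] by (metis diff_self_eq_0 le_refl mult_0_right)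
qed

lemma word_gf_eq: "word_gf (2 * l) {} K = cayley ^ (l * K)"
proof (induction K)
  case 0
  show ?case
  proof (rule fps_ext)
    fix n show "word_gf (2 * l) {} 0 $ n = cayley ^ (l * 0) $ n"
      by (cases n) (simp_all add: word_gf_def word_count_def)
  qed
qed (simp add: word_gf_Suc power_add)

section \<open>The coefficients of powers of (1+x)/(1-x)\<close>

lemma X_over_one_minus_X_power_nth:
  assumes "n \<ge> 1"
  shows "(fps_X * inverse (1 - fps_X)) ^ m $ n
           = (if 1 \<le> m then of_nat ((n - 1) choose (m - 1)) else 0 :: rat)"
proof (cases "m = 0")
  case False
  have "inverse ((1 - fps_X) ^ m) = Abs_fps (\<lambda>k. of_nat ((m + k - 1) choose k) :: rat)"
    using one_minus_const_fps_X_neg_power'[of m "1 :: rat"] False by simp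
  then have "(fps_X * inverse (1 - fps_X)) ^ m $ n
      = (if n < m then 0 else of_nat ((m + (n - m) - 1) choose (n - m)) :: rat)"
    by (simp add: power_mult_distrib fps_inverse_power[symmetric] fps_X_power_mult_nth)
  moreover have "(n - 1) choose (n - m) = (n - 1) choose (m - 1)" if "m \<le> n"
    using binomial_symmetric[of "m - 1" "n - 1"] False that by simp
  moreover have "n - 1 < m - 1" if "n < m" using that assms by linarith
  ultimately show ?thesis using False by (auto simp: binomial_eq_0)
qed (use assms in simp)

lemma cayley_power_nth:
  assumes "n \<ge> 1"
  shows "cayley ^ N $ n
           = (\<Sum>m=1..n. of_nat (N choose m) * of_nat ((n - 1) choose (m - 1)) * 2 ^ m)"
proof -
  let ?y = "fps_X * inverse (1 - fps_X) :: rat fps"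
  let ?t = "\<lambda>m. of_nat (N choose m) * of_nat ((n - 1) choose (m - 1)) * 2 ^ m :: rat"
  have "(1 - fps_X) * cayley = (1 - fps_X) * (2 * ?y + 1)"
    using cayley_mult inverse_mult_eq_1[of "1 - fps_X :: rat fps"] by (simp, algebra)
  then have "cayley = 2 * ?y + 1" using one_minus_X_nonzero by simp
  then have "cayley ^ N = (\<Sum>m\<le>N. of_nat (N choose m) * (2 * ?y) ^ m)"
    unfolding \<open>cayley = 2 * ?y + 1\<close> binomial_ring by (simp only: power_one mult_1_right)
  also have "\<dots> = (\<Sum>m\<le>N. fps_const (of_nat (N choose m) * 2 ^ m) * ?y ^ m)"
    by (simp add: power_mult_distrib fps_of_nat[symmetric] numeral_fps_const mult.assoc[symmetric])
  finally have "cayley ^ N $ n = (\<Sum>m\<le>N. of_nat (N choose m) * 2 ^ m * (?y ^ m $ n))"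
    by (simp add: fps_sum_nth)
  also have "\<dots> = (\<Sum>m\<le>N. if 1 \<le> m then ?t m else 0)"
    by (intro sum.cong refl) (simp add: X_over_one_minus_X_power_nth[OF assms])
  also have "\<dots> = (\<Sum>m\<le>N + n. if 1 \<le> m then ?t m else 0)"
    by (intro sum.mono_neutral_left) (auto simp: binomial_eq_0)
  also have "\<dots> = (\<Sum>m=1..n. if 1 \<le> m then ?t m else 0)"
    by (intro sum.mono_neutral_right) (use assms in \<open>auto simp: binomial_eq_0\<close>)
  also have "\<dots> = (\<Sum>m=1..n. ?t m)" by (intro sum.cong) auto
  finally show ?thesis .
qed

lemma sum_enriched_counts_eq:
  assumes "n \<ge> 1"
  shows "(\<Sum>p | p permutes {1..n}.
            of_nat (enriched_count (ascent p) n (2 * k)) * of_nat (enriched_count (ascent (inv p)) n (2 * l)) :: rat)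
         = (\<Sum>m=1..n. of_nat ((2 * k * l) choose m) * of_nat ((n - 1) choose (m - 1)) * 2 ^ m)"
proof -
  have "(\<Sum>p | p permutes {1..n}.
            of_nat (enriched_count (ascent p) n (2 * k)) * of_nat (enriched_count (ascent (inv p)) n (2 * l)) :: rat)
      = of_nat (\<Sum>p | p permutes {1..n}. enriched_count (ascent p) n (2 * k) * enriched_count (ascent (inv p)) n (2 * l))"
    by simp
  also have "\<dots> = word_gf (2 * l) {} (2 * k) $ n"
    unfolding sum_enriched_counts_eq_sum_words by (simp add: word_gf_def word_count_def)
  also have "\<dots> = cayley ^ (2 * k * l) $ n"
    unfolding word_gf_eq by (simp only: mult_ac)
  finally show ?thesis using cayley_power_nth[OF assms] by simp
qed

section \<open>Series in two variables\<close>

text \<open>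
  Substitution of \<open>t\<close> for the variable of a series.  The coefficients become constants in \<open>s\<close>, whereas
  the series in \<open>s\<close> are embedded by \<open>fps_const\<close>; products of the two kinds of series have product
  coefficients.
\<close>

definition in_t :: "rat fps \<Rightarrow> rat fps fps" where
  "in_t f = Abs_fps (\<lambda>l. fps_const (f $ l))"

lemma in_t_mult: "in_t (f * g) = in_t f * in_t g"
proof (rule fps_ext)
  fix n
  have "fps_const (\<Sum>i\<in>A. h i) = (\<Sum>i\<in>A. fps_const (h i))" for h :: "nat \<Rightarrow> rat" and A
    by (induction A rule: infinite_finite_induct) (simp_all flip: fps_const_add)
  then show "in_t (f * g) $ n = (in_t f * in_t g) $ n"
    by (simp add: in_t_def fps_mult_nth)
qed

lemma in_t_add: "in_t (f + g) = in_t f + in_t g"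
  and in_t_diff: "in_t (f - g) = in_t f - in_t g"
  and in_t_one: "in_t 1 = 1"
  and in_t_X: "in_t fps_X = var_t"
  by (auto simp: in_t_def var_t_def fps_eq_iff fps_X_def)

lemma in_t_power: "in_t (f ^ k) = in_t f ^ k"
  by (induction k) (simp_all add: in_t_one in_t_mult)

lemma in_t_numeral: "in_t (numeral k) = numeral k"
  by (induction k) (simp_all only: numeral.simps in_t_add in_t_one)

lemma fps_const_numeral: "fps_const (numeral k :: rat fps) = numeral k"
  by (simp add: numeral_fps_const)

lemma bivar_divide_eqI:
  fixes F G H :: "rat fps fps"
  assumes "G $ 0 $ 0 \<noteq> 0" "H * G = F"
  shows "F / G = H"
proof -
  have "G \<noteq> 0" using assms(1) by auto
  moreover have "F / G * G = H * G"
    using bivar_divide_mult_cancel[OF assms(1), of F] assms(2) by simp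
  ultimately show ?thesis by simp
qed

lemmas in_t_simps = in_t_add in_t_diff in_t_one in_t_X in_t_power in_t_numeral in_t_mult

lemma nth_0_0_simps:
  "var_s $ 0 $ 0 = 0" "var_t $ 0 $ 0 = 0"
  by (simp_all add: var_s_def var_t_def)

lemma in_s_eqs:
  "fps_const cayley * (1 - var_s) = 1 + var_s"
  "fps_const peak_arg * (1 + var_s)\<^sup>2 = 4 * var_s"
proof -
  have 1: "1 - var_s = fps_const (1 - fps_X)" "1 + var_s = fps_const (1 + fps_X)"
    by (simp_all add: var_s_def flip: fps_const_sub fps_const_add)
  show "fps_const cayley * (1 - var_s) = 1 + var_s"
    by (simp only: 1 fps_const_mult cayley_mult)
  have "fps_const (peak_arg * (1 + fps_X)\<^sup>2) = 4 * var_s"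
    unfolding peak_arg_mult by (simp add: var_s_def fps_const_numeral flip: fps_const_mult)
  then show "fps_const peak_arg * (1 + var_s)\<^sup>2 = 4 * var_s"
    by (simp add: 1)
qed

lemma in_t_eqs:
  "in_t cayley * (1 - var_t) = 1 + var_t"
  "in_t peak_arg * (1 + var_t)\<^sup>2 = 4 * var_t"
  using arg_cong[OF cayley_mult, of in_t] arg_cong[OF peak_arg_mult, of in_t]
  by (simp_all only: in_t_simps)

lemma cayley_quotient:
  "((1 + var_s) * (1 + var_t)) / ((1 - var_s) * (1 - var_t)) = fps_const cayley * in_t cayley"
proof (rule bivar_divide_eqI)
  show "fps_const cayley * in_t cayley * ((1 - var_s) * (1 - var_t)) = (1 + var_s) * (1 + var_t)"
    using in_s_eqs(1) in_t_eqs(1) by algebra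
qed (simp add: nth_0_0_simps)

lemma peak_arg_s: "4 * var_s / (1 + var_s)\<^sup>2 = fps_const peak_arg"
  by (rule bivar_divide_eqI[OF _ in_s_eqs(2)]) (simp add: nth_0_0_simps power2_eq_square)

lemma peak_arg_t: "4 * var_t / (1 + var_t)\<^sup>2 = in_t peak_arg"
  by (rule bivar_divide_eqI[OF _ in_t_eqs(2)]) (simp add: nth_0_0_simps power2_eq_square)

lemma enriched_even_eq_pk:
  assumes "p permutes {1..n}" "n \<ge> 1"
  shows "2 * enriched_even (ascent p) n = cayley ^ (n + 1) * peak_arg ^ (pk n p + 1)"
  using assms enriched_even_eq_peaks[of "ascent p" "n - 1"] pk_eq_peaks[of p n] by (simp add: ascent_def)

theorem theorem1:
  fixes n :: nat
  assumes "n \<ge> 1"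
  shows "(1 / 4) * (((1 + var_s) * (1 + var_t)) / ((1 - var_s) * (1 - var_t))) ^ (n + 1)
           * peak_poly n (4 * var_s / (1 + var_s)\<^sup>2) (4 * var_t / (1 + var_t)\<^sup>2)
         = bivar_fps (\<lambda>k l. \<Sum>m = 1..n.
             of_nat ((2 * k * l) choose m) * of_nat ((n - 1) choose (m - 1)) * 2 ^ m)"
proof -
  let ?P = "{p. p permutes {1..n}}"
  let ?E = "\<lambda>p. enriched_even (ascent p) n"
  have "(4 :: rat fps fps) $ 0 $ 0 = 4" by (simp flip: fps_const_numeral add: numeral_fps_const)
  then have quarter: "(1 / 4 :: rat fps fps) * 4 = 1"
    by (intro bivar_divide_mult_cancel) simp
  have two: "fps_const (2 * f) = 2 * fps_const f" for f :: "rat fps"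
    by (simp add: fps_const_numeral flip: fps_const_mult)
  have halves: "(1 / 4) * (a * c) * (b * d) = x * y"
    if "2 * x = a * b" "2 * y = c * d" for a b c d x y :: "rat fps fps"
  proof -
    have "(1 / 4) * (a * c) * (b * d) = (1 / 4) * ((a * b) * (c * d))"
      by (simp only: mult_ac)
    also have "\<dots> = (1 / 4) * (2 * 2) * (x * y)"
      unfolding that[symmetric] by (simp only: mult_ac)
    finally show ?thesis using quarter by simp
  qed
  have summand: "(1 / 4) * (fps_const cayley * in_t cayley) ^ (n + 1)
        * (fps_const peak_arg ^ (pk n p + 1) * in_t peak_arg ^ (pk n (inv p) + 1))
      = fps_const (?E p) * in_t (?E (inv p))" if p: "p permutes {1..n}" for p
  proof -
    have "2 * fps_const (?E p) = fps_const cayley ^ (n + 1) * fps_const peak_arg ^ (pk n p + 1)"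
      using arg_cong[OF enriched_even_eq_pk[OF p assms], of fps_const]
      unfolding two by (simp only: fps_const_power fps_const_mult)
    moreover have "2 * in_t (?E (inv p)) = in_t cayley ^ (n + 1) * in_t peak_arg ^ (pk n (inv p) + 1)"
      using arg_cong[OF enriched_even_eq_pk[OF permutes_inv[OF p] assms], of in_t]
      by (simp only: in_t_simps)
    ultimately show ?thesis
      unfolding power_mult_distrib by (rule halves)
  qed
  have "(1 / 4) * (((1 + var_s) * (1 + var_t)) / ((1 - var_s) * (1 - var_t))) ^ (n + 1)
           * peak_poly n (4 * var_s / (1 + var_s)\<^sup>2) (4 * var_t / (1 + var_t)\<^sup>2)
      = (\<Sum>p\<in>?P. fps_const (?E p) * in_t (?E (inv p)))"
    unfolding cayley_quotient peak_arg_s peak_arg_t peak_poly_def sum_distrib_left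
    by (intro sum.cong refl summand) simp
  also have "\<dots> = bivar_fps (\<lambda>k l. \<Sum>p\<in>?P.
      of_nat (enriched_count (ascent p) n (2 * k)) * of_nat (enriched_count (ascent (inv p)) n (2 * l)))"
    by (intro fps_ext) (simp add: bivar_fps_def in_t_def enriched_even_def fps_sum_nth)
  also have "\<dots> = bivar_fps (\<lambda>k l. \<Sum>m = 1..n.
      of_nat ((2 * k * l) choose m) * of_nat ((n - 1) choose (m - 1)) * 2 ^ m)"
    unfolding sum_enriched_counts_eq[OF assms] ..
  finally show ?thesis .
qed

end
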